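(* Let $k,n\in\mathbb{N}$. For every $m\in\mathbb{N}_0$ and every $\vec\xi=(\xi_0,\ldots,\xi_{k-1})\in\mathbb{C}^k$ the following identities hold: $$\mathcal{H}_m(\vec\xi\otimes\vec\zeta_n)=\begin{cases}\mathcal{H}_{m/n}(\vec\xi^{\,n}) & \text{if } n \text{ divides } m,\\ 0 & \text{otherwise,}\end{cases}$$ $$\mathcal{E}_m(\vec\xi\otimes\vec\zeta_n)=\begin{cases}(-1)^{m-m/n}\,\mathcal{E}_{m/n}(\vec\xi^{\,n}) & \text{if } n \text{ divides } m \text{ and } m\le kn,\\ 0 & \text{otherwise.}\end{cases}$$
   Context: $\mathbb{N}=\{1,2,\ldots\}$, $\mathbb{N}_0=\mathbb{N}\cup\{0\}$. $\zeta_n:=e^{2\pi i/n}$ and $\vec\zeta_n:=(1,\zeta_n,\ldots,\zeta_n^{n-1})\in\mathbb{C}^n$. For $\vec\xi=(\xi_0,\ldots,\xi_{k-1})\in\mathbb{C}^k$, $\vec\xi^{\,n}:=(\xi_0^n,\ldots,\xi_{k-1}^n)$. The Kronecker product of $\vec x=(x_1,\ldots,x_a)\in\mathbb{C}^a$ and $\vec y=(y_1,\ldots,y_b)\in\mathbb{C}^b$ is $\vec x\otimes\vec y=(x_1\vec y,\ldots,x_a\vec y)\in\mathbb{C}^{ab}$, where $x_j\vec y=(x_jy_1,\ldots,x_jy_b)$. For $\vec z=(z_1,\ldots,z_r)\in\mathbb{C}^r$, the elementary symmetric polynomials are $\mathcal{E}_0(\vec z):=1$, $\mathcal{E}_m(\vec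 z):=\sum_{1\le j_1<\cdots<j_m\le r}z_{j_1}\cdots z_{j_m}$ for $1\le m\le r$, $\mathcal{E}_m(\vec z):=0$ for $m>r$; the complete homogeneous symmetric polynomials are $\mathcal{H}_0(\vec z):=1$ and $\mathcal{H}_m(\vec z):=\sum_{1\le j_1\le\cdots\le j_m\le r}z_{j_1}\cdots z_{j_m}$ for $m\ge1$. *)

theory Defs
  imports Complex_Main
begin

text \<open>
  A vector in \<open>\<complex>\<^sup>r\<close> is a list of length \<open>r\<close>; entries are indexed from 0.
\<close>

definition zeta :: "nat \<Rightarrow> complex" where
  "zeta n = exp (2 * of_real pi * \<i> / of_nat n)"

definition zeta_vec :: "nat \<Rightarrow> complex list" where
  "zeta_vec n = map (\<lambda>j. zeta n ^ j) [0..<n]"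

definition vec_pow :: "complex list \<Rightarrow> nat \<Rightarrow> complex list" where
  "vec_pow xs n = map (\<lambda>x. x ^ n) xs"

definition kronecker :: "complex list \<Rightarrow> complex list \<Rightarrow> complex list" where
  "kronecker xs ys = concat (map (\<lambda>x. map (\<lambda>y. x * y) ys) xs)"

text \<open>
  The tuples \<open>j\<^sub>1 < \<dots> < j\<^sub>m\<close> (respectively \<open>j\<^sub>1 \<le> \<dots> \<le> j\<^sub>m\<close>) of indices below \<open>r\<close>.
  For \<open>m = 0\<close> there is exactly the empty tuple, which contributes the empty product 1.
\<close>

definition strict_tuples :: "nat \<Rightarrow> nat \<Rightarrow> nat list set" where
  "strict_tuples r m = {js. length js = m \<and> set js \<subseteq> {..<r} \<and> sorted_wrt (<) js}"

definition weak_tuples :: "nat \<Rightarrow> nat \<Rightarrow> nat list set" where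
  "weak_tuples r m = {js. length js = m \<and> set js \<subseteq> {..<r} \<and> sorted_wrt (\<le>) js}"

definition elem_sym :: "nat \<Rightarrow> complex list \<Rightarrow> complex" where
  "elem_sym m zs = (\<Sum>js\<in>strict_tuples (length zs) m. \<Prod>j\<leftarrow>js. zs ! j)"

definition complete_sym :: "nat \<Rightarrow> complex list \<Rightarrow> complex" where
  "complete_sym m zs = (\<Sum>js\<in>weak_tuples (length zs) m. \<Prod>j\<leftarrow>js. zs ! j)"

lemma finite_weak_tuples: "finite (weak_tuples r m)"
  by (rule finite_subset[OF _ finite_lists_length_eq[of "{..<r}" m]])
    (auto simp: weak_tuples_def)

lemma finite_strict_tuples: "finite (strict_tuples r m)"
  by (rule finite_subset[OF _ finite_lists_length_eq[of "{..<r}" m]])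
    (auto simp: strict_tuples_def)

lemma elem_sym_0: "elem_sym 0 zs = 1"
proof -
  have "strict_tuples (length zs) 0 = {[]}"
    by (auto simp: strict_tuples_def)
  then show ?thesis by (simp add: elem_sym_def)
qed

lemma complete_sym_0: "complete_sym 0 zs = 1"
proof -
  have "weak_tuples (length zs) 0 = {[]}"
    by (auto simp: weak_tuples_def)
  then show ?thesis by (simp add: complete_sym_def)
qed

lemma elem_sym_eq_0:
  assumes "m > length zs"
  shows "elem_sym m zs = 0"
proof -
  have "length js \<le> length zs" if "set js \<subseteq> {..<length zs}" "sorted_wrt (<) js" for js
  proof -
    have "distinct js" using that(2) by (simp add: strict_sorted_iff)
    then have "length js = card (set js)" by (simp add: distinct_card)
    also have "\<dots> \<le> card {..<length zs}" using that(1) by (intro card_mono) auto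
    finally show ?thesis by simp
  qed
  then have "strict_tuples (length zs) m = {}"
    using assms by (fastforce simp: strict_tuples_def)
  then show ?thesis by (simp add: elem_sym_def)
qed

end

theory Submission
  imports Defs "HOL-Computational_Algebra.Polynomial_FPS"
begin

text \<open>
  The generating functions of the elementary and complete homogeneous symmetric polynomials are
  \<open>E(X) = \<Prod>(1 + z\<^sub>i X)\<close> and \<open>H(X) = \<Prod>(1 - z\<^sub>i X)\<^sup>-\<^sup>1\<close>. For the vector \<open>\<xi> \<otimes> \<zeta>\<^sub>n\<close> the factors belonging to
  one entry \<open>x\<close> of \<open>\<xi>\<close> multiply, by \<open>\<Prod>\<^sub>j (1 - \<zeta>\<^sub>n\<^sup>j Y) = 1 - Y\<^sup>n\<close> at \<open>Y = \<plusminus>x X\<close>, to a polynomial in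
  \<open>x\<^sup>n X\<^sup>n\<close>. Hence both generating functions arise from those of \<open>\<xi>\<^sup>n\<close> by substituting \<open>\<plusminus>X\<^sup>n\<close> for
  \<open>X\<close>, and it remains to compare coefficients.
\<close>

unbundle fps_syntax

section \<open>Recurrences in the last variable\<close>

text \<open>In a strictly increasing tuple of indices up to \<open>r\<close> only the last entry can
  be \<open>r\<close>; deleting it leaves entries below \<open>r\<close>.\<close>

lemma strict_tuples_Suc:
  "strict_tuples (Suc r) (Suc m) = strict_tuples r (Suc m) \<union> (\<lambda>js. js @ [r]) ` strict_tuples r m"
  (is "?L = ?R")
proof
  show "?L \<subseteq> ?R"
  proof
    fix js assume js: "js \<in> ?L"
    then obtain ks i where [simp]: "js = ks @ [i]"
      by (cases js rule: rev_cases) (auto simp: strict_tuples_def)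
    show "js \<in> ?R"
      using js by (cases "i = r") (force simp: strict_tuples_def sorted_wrt_append)+
  qed
qed (auto simp: strict_tuples_def sorted_wrt_append less_Suc_eq)

text \<open>After a last entry \<open>r\<close> is deleted, the remaining tuple may still contain
  \<open>r\<close>; hence \<open>Suc r\<close> in the second set.\<close>

lemma weak_tuples_Suc:
  "weak_tuples (Suc r) (Suc m) = weak_tuples r (Suc m) \<union> (\<lambda>js. js @ [r]) ` weak_tuples (Suc r) m"
  (is "?L = ?R")
proof
  show "?L \<subseteq> ?R"
  proof
    fix js assume js: "js \<in> ?L"
    then obtain ks i where [simp]: "js = ks @ [i]"
      by (cases js rule: rev_cases) (auto simp: weak_tuples_def)
    show "js \<in> ?R"
      using js by (cases "i = r") (force simp: weak_tuples_def sorted_wrt_append)+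
  qed
qed (auto simp: weak_tuples_def sorted_wrt_append lessThan_Suc_atMost subset_eq)

lemma prod_list_nth_append:
  assumes "set js \<subseteq> {..<length zs}"
  shows "(\<Prod>j\<leftarrow>js. (zs @ ys) ! j) = (\<Prod>j\<leftarrow>js. zs ! j)"
  using assms by (intro arg_cong[where f = prod_list] map_cong) (auto simp: nth_append)

lemma elem_sym_snoc:
  "elem_sym (Suc m) (zs @ [x]) = elem_sym (Suc m) zs + x * elem_sym m zs"
proof -
  let ?r = "length zs"
  let ?p = "\<lambda>js. \<Prod>j\<leftarrow>js. (zs @ [x]) ! j"
  have "strict_tuples ?r (Suc m) \<inter> (\<lambda>js. js @ [?r]) ` strict_tuples ?r m = {}"
    by (auto simp: strict_tuples_def)
  then have "elem_sym (Suc m) (zs @ [x]) =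
      sum ?p (strict_tuples ?r (Suc m)) + sum ?p ((\<lambda>js. js @ [?r]) ` strict_tuples ?r m)"
    by (simp add: elem_sym_def strict_tuples_Suc sum.union_disjoint finite_strict_tuples)
  also have "sum ?p (strict_tuples ?r (Suc m)) = elem_sym (Suc m) zs"
    unfolding elem_sym_def
    by (intro sum.cong prod_list_nth_append) (auto simp: strict_tuples_def)
  also have "sum ?p ((\<lambda>js. js @ [?r]) ` strict_tuples ?r m) =
      (\<Sum>js\<in>strict_tuples ?r m. x * ?p js)"
    by (subst sum.reindex) (auto simp: inj_on_def mult.commute)
  also have "\<dots> = x * elem_sym m zs"
    unfolding elem_sym_def sum_distrib_left
    by (intro sum.cong refl arg_cong2[where f = "(*)"] prod_list_nth_append)
      (auto simp: strict_tuples_def)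
  finally show ?thesis .
qed

lemma complete_sym_snoc:
  "complete_sym (Suc m) (zs @ [x]) = complete_sym (Suc m) zs + x * complete_sym m (zs @ [x])"
proof -
  let ?r = "length zs"
  let ?p = "\<lambda>js. \<Prod>j\<leftarrow>js. (zs @ [x]) ! j"
  have "weak_tuples ?r (Suc m) \<inter> (\<lambda>js. js @ [?r]) ` weak_tuples (Suc ?r) m = {}"
    by (auto simp: weak_tuples_def)
  then have "complete_sym (Suc m) (zs @ [x]) =
      sum ?p (weak_tuples ?r (Suc m)) + sum ?p ((\<lambda>js. js @ [?r]) ` weak_tuples (Suc ?r) m)"
    by (simp add: complete_sym_def weak_tuples_Suc sum.union_disjoint finite_weak_tuples)
  also have "sum ?p (weak_tuples ?r (Suc m)) = complete_sym (Suc m) zs"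
    unfolding complete_sym_def
    by (intro sum.cong prod_list_nth_append) (auto simp: weak_tuples_def)
  also have "sum ?p ((\<lambda>js. js @ [?r]) ` weak_tuples (Suc ?r) m) =
      (\<Sum>js\<in>weak_tuples (Suc ?r) m. x * ?p js)"
    by (subst sum.reindex) (auto simp: inj_on_def mult.commute)
  also have "\<dots> = x * complete_sym m (zs @ [x])"
    by (simp add: complete_sym_def sum_distrib_left)
  finally show ?thesis .
qed

section \<open>Generating functions\<close>

text \<open>The sign lets one definition serve both series: E has the factors
  \<open>lin (- z)\<close>, and the inverse of H has the factors \<open>lin z\<close>.\<close>

definition lin :: "complex \<Rightarrow> complex fps" where
  "lin x = 1 - fps_const x * fps_X"

lemma lin_nth:
  "lin x $ 0 = 1"
  "(f * lin x) $ Suc m = f $ Suc m - x * f $ m"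
proof -
  have "f * lin x = f - fps_const x * (f * fps_X)"
    by (simp add: lin_def algebra_simps)
  then show "(f * lin x) $ Suc m = f $ Suc m - x * f $ m"
    by simp
qed (simp add: lin_def)

lemma elem_sym_generating_function:
  "Abs_fps (\<lambda>m. elem_sym m zs) = (\<Prod>z\<leftarrow>zs. lin (- z))"
proof (induction zs rule: rev_induct)
  case Nil
  have "elem_sym m [] = (1 :: complex fps) $ m" for m
    by (cases m) (simp_all add: elem_sym_0 elem_sym_eq_0)
  then show ?case by (simp add: fps_eq_iff)
next
  case (snoc x zs)
  have "Abs_fps (\<lambda>m. elem_sym m (zs @ [x])) = Abs_fps (\<lambda>m. elem_sym m zs) * lin (- x)"
  proof (rule fps_ext)
    fix m
    show "Abs_fps (\<lambda>m. elem_sym m (zs @ [x])) $ m = (Abs_fps (\<lambda>m. elem_sym m zs) * lin (- x)) $ m"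
      by (cases m) (simp_all add: lin_nth elem_sym_0 elem_sym_snoc)
  qed
  with snoc.IH show ?case by simp
qed

text \<open>By \<open>complete_sym_snoc\<close>, multiplication by \<open>lin x\<close> removes the
  last variable \<open>x\<close>, so all factors together reduce the series to that of the empty
  list.\<close>

lemma complete_sym_generating_function:
  "Abs_fps (\<lambda>m. complete_sym m zs) * (\<Prod>z\<leftarrow>zs. lin z) = 1"
proof (induction zs rule: rev_induct)
  case Nil
  have "weak_tuples 0 (Suc m) = {}" for m
    by (auto simp: weak_tuples_def)
  then have "complete_sym m [] = (1 :: complex fps) $ m" for m
    by (cases m) (simp_all add: complete_sym_0, simp add: complete_sym_def)
  then show ?case by (simp add: fps_eq_iff)
next
  case (snoc x zs)
  have "Abs_fps (\<lambda>m. complete_sym m (zs @ [x])) * lin x = Abs_fps (\<lambda>m. complete_sym m zs)"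
  proof (rule fps_ext)
    fix m
    show "(Abs_fps (\<lambda>m. complete_sym m (zs @ [x])) * lin x) $ m = Abs_fps (\<lambda>m. complete_sym m zs) $ m"
      by (cases m) (simp_all add: lin_nth complete_sym_0 complete_sym_snoc)
  qed
  then have "Abs_fps (\<lambda>m. complete_sym m (zs @ [x])) * (\<Prod>z\<leftarrow>zs @ [x]. lin z) =
      Abs_fps (\<lambda>m. complete_sym m zs) * (\<Prod>z\<leftarrow>zs. lin z)"
    by (simp flip: mult.assoc)
  with snoc.IH show ?case by simp
qed

section \<open>Roots of unity and products of linear factors\<close>

lemma bij_betw_zeta_powers:
  assumes "n \<ge> 1"
  shows "bij_betw (\<lambda>j. zeta n ^ j) {..<n} {w. w ^ n = 1}"
proof -
  have "zeta n ^ j = cis (2 * pi * real j / real n)" for j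
    by (simp add: zeta_def cis_conv_exp flip: exp_of_nat_mult) (simp add: field_simps)
  then show ?thesis using bij_betw_roots_unity[of n] assms by simp
qed

text \<open>Both sides have degree at most \<open>n\<close> and agree at \<open>n + 1\<close>
  points, namely 0 and the \<open>n\<close>-th roots of unity.\<close>

lemma prod_roots_of_unity_poly:
  assumes "n \<ge> 1"
  shows "(\<Prod>j<n. [:1, - (zeta n ^ j):]) = 1 - monom 1 n"
proof -
  let ?U = "{w :: complex. w ^ n = 1}"
  let ?p = "\<Prod>w\<in>?U. [:1, - w:]"
  have fin: "finite ?U" and card: "card ?U = n"
    using bij_betw_finite[OF bij_betw_zeta_powers[OF assms]]
      bij_betw_same_card[OF bij_betw_zeta_powers[OF assms]] by simp_all
  have "?p = 1 - monom 1 n"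
  proof (rule poly_eqI_degree[of "insert 0 ?U"])
    fix z assume z: "z \<in> insert 0 ?U"
    show "poly ?p z = poly (1 - monom 1 n) z"
    proof (cases "z = 0")
      case True
      then show ?thesis using assms by (simp add: poly_prod poly_monom)
    next
      case False
      with z have "z ^ n = 1" by simp
      \<comment> \<open>The factor vanishing at \<open>z\<close> is the one that belongs to the
        inverse root.\<close>
      then have "inverse z \<in> ?U" by (simp add: power_inverse)
      moreover have "poly [:1, - inverse z:] z = 0" using False by simp
      ultimately have "poly ?p z = 0" unfolding poly_prod using fin by (rule prod_zero[rotated, OF bexI[rotated]])
      with \<open>z ^ n = 1\<close> show ?thesis by (simp add: poly_monom)
    qed
  next
    have "0 \<notin> ?U" using assms by (simp add: power_0_left)
    with fin card have c: "card (insert 0 ?U) = Suc n" by simp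
    have "degree ?p \<le> (\<Sum>w\<in>?U. 1)"
      by (rule order.trans[OF degree_prod_sum_le[OF fin] sum_mono]) simp
    then show "card (insert 0 ?U) > degree ?p" using c card by simp
    have "degree (1 - monom (1::complex) n) \<le> n"
      by (rule degree_diff_le) (simp_all add: degree_monom_le)
    then show "card (insert 0 ?U) > degree (1 - monom (1::complex) n)" using c by simp
  qed
  then show ?thesis
    using prod.reindex_bij_betw[OF bij_betw_zeta_powers[OF assms], of "\<lambda>w. [:1, - w:]"] by simp
qed

lemma prod_lin_zeta:
  assumes "n \<ge> 1"
  shows "(\<Prod>z\<leftarrow>zeta_vec n. lin (x * z)) = 1 - fps_const (x ^ n) * fps_X ^ n"
proof -
  have "(\<Prod>z\<leftarrow>zeta_vec n. lin (x * z)) = (\<Prod>j<n. lin (x * zeta n ^ j))"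
    by (simp add: zeta_vec_def o_def lessThan_atLeast0 flip: prod.distinct_set_conv_list)
  \<comment> \<open>Composing with \<open>[:0, x:]\<close> replaces the variable by \<open>x\<close>
    times it; no division by \<open>x\<close> occurs, so \<open>x = 0\<close> is covered.\<close>
  also have "\<dots> = (\<Prod>j<n. fps_of_poly (pcompose [:1, - (zeta n ^ j):] [:0, x:]))"
    by (simp add: lin_def fps_of_poly_pCons pcompose_pCons mult_ac flip: fps_const_neg)
  also have "\<dots> = fps_of_poly (pcompose (\<Prod>j<n. [:1, - (zeta n ^ j):]) [:0, x:])"
    by (simp add: fps_of_poly_prod pcompose_prod)
  also have "\<dots> = 1 - fps_const (x ^ n) * fps_X ^ n"
  proof -
    have "pcompose (monom 1 n) [:0, x:] = monom (x ^ n) n"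
      by (induction n) (simp_all add: monom_0 monom_Suc pcompose_pCons smult_monom)
    then show ?thesis
      by (simp add: prod_roots_of_unity_poly[OF assms] pcompose_diff pcompose_1
          fps_of_poly_diff fps_of_poly_monom)
  qed
  finally show ?thesis .
qed

text \<open>The scalar \<open>c\<close> will be 1 for H and -1 for E.\<close>

lemma prod_lin_kronecker:
  assumes "n \<ge> 1"
  shows "(\<Prod>z\<leftarrow>kronecker xs (zeta_vec n). lin (c * z)) =
    (\<Prod>z\<leftarrow>vec_pow xs n. 1 - fps_const (c ^ n * z) * fps_X ^ n)"
proof (induction xs)
  case (Cons x xs)
  then show ?case
    using prod_lin_zeta[OF assms, of "c * x"]
    by (simp add: kronecker_def vec_pow_def o_def mult.assoc power_mult_distrib)
qed (simp add: kronecker_def vec_pow_def)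

section \<open>Substitution of a monomial into a power series\<close>

lemma lin_compose:
  assumes "n \<ge> 1"
  shows "lin z oo (fps_const c * fps_X ^ n) = 1 - fps_const (c * z) * fps_X ^ n"
proof -
  \<comment> \<open>A zero constant term of the inner series makes composition distribute over
    products.\<close>
  have "(fps_const c * fps_X ^ n) $ 0 = 0" using assms by simp
  then show ?thesis
    by (simp add: lin_def fps_compose_sub_distrib fps_compose_mult_distrib mult_ac
        flip: fps_const_mult)
qed

lemma prod_lin_compose:
  assumes "n \<ge> 1"
  shows "(\<Prod>z\<leftarrow>zs. lin (f z)) oo (fps_const c * fps_X ^ n) =
    (\<Prod>z\<leftarrow>zs. 1 - fps_const (c * f z) * fps_X ^ n)"
  using assms by (induction zs) (simp_all add: fps_compose_mult_distrib lin_compose)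

lemma fps_compose_monom_nth:
  fixes f :: "complex fps"
  assumes "n \<ge> 1"
  shows "(f oo (fps_const c * fps_X ^ n)) $ m = (if n dvd m then c ^ (m div n) * f $ (m div n) else 0)"
proof -
  have "(f oo (fps_const c * fps_X ^ n)) $ m = (\<Sum>i=0..m. if m = n * i then c ^ i * f $ i else 0)"
    unfolding fps_compose_nth
    by (intro sum.cong) (auto simp: power_mult_distrib simp flip: power_mult)
  \<comment> \<open>For positive \<open>n\<close> the only possible solution of
    \<open>m = n * i\<close> is \<open>i = m div n\<close>, which lies in the range of
    summation.\<close>
  also have "\<dots> = (\<Sum>i=0..m. if i = m div n then if n dvd m then c ^ i * f $ i else 0 else 0)"
    using assms by (intro sum.cong) auto
  also have "\<dots> = (if n dvd m then c ^ (m div n) * f $ (m div n) else 0)"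
    by simp
  finally show ?thesis .
qed

section \<open>Comparison of coefficients\<close>

text \<open>The series of the Kronecker product and the substituted series are both inverse to
  \<open>?P\<close>, so they coincide by cancellation.\<close>

lemma complete_sym_kronecker_zeta:
  assumes "n \<ge> 1"
  shows "complete_sym m (kronecker xs (zeta_vec n)) =
    (if n dvd m then complete_sym (m div n) (vec_pow xs n) else 0)"
proof -
  let ?H = "\<lambda>zs. Abs_fps (\<lambda>m. complete_sym m zs)"
  \<comment> \<open>The scalar 1 is kept to match the substitution lemmas with general
    scalar.\<close>
  let ?X = "fps_const 1 * fps_X ^ n :: complex fps"
  let ?P = "\<Prod>z\<leftarrow>vec_pow xs n. 1 - fps_const z * fps_X ^ n"
  have X0: "?X $ 0 = 0" using assms by simp
  have 1: "?H (kronecker xs (zeta_vec n)) * ?P = 1"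
    using complete_sym_generating_function[of "kronecker xs (zeta_vec n)"]
      prod_lin_kronecker[OF assms, of 1 xs] by simp
  have "(?H (vec_pow xs n) * (\<Prod>z\<leftarrow>vec_pow xs n. lin z)) oo ?X = 1"
    by (simp only: complete_sym_generating_function fps_compose_1)
  then have 2: "(?H (vec_pow xs n) oo ?X) * ?P = 1"
    using prod_lin_compose[OF assms, of "\<lambda>z. z" "vec_pow xs n" 1]
    by (simp add: fps_compose_mult_distrib[OF X0] del: fps_const_1_eq_1)
  have "?H (kronecker xs (zeta_vec n)) = ?H (vec_pow xs n) oo ?X"
  proof (rule mult_right_cancel[THEN iffD1])
    show "?P \<noteq> 0" using 1 by (intro notI) (simp only: mult_zero_right zero_neq_one)
    show "?H (kronecker xs (zeta_vec n)) * ?P = (?H (vec_pow xs n) oo ?X) * ?P"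
      by (simp only: 1 2)
  qed
  then have "?H (kronecker xs (zeta_vec n)) $ m = (?H (vec_pow xs n) oo ?X) $ m"
    by simp
  then show ?thesis by (simp only: fps_compose_monom_nth[OF assms]) simp
qed

lemma elem_sym_kronecker_zeta:
  assumes "n \<ge> 1"
  shows "elem_sym m (kronecker xs (zeta_vec n)) =
    (if n dvd m then (-1) ^ (m - m div n) * elem_sym (m div n) (vec_pow xs n) else 0)"
proof -
  let ?E = "\<lambda>zs. Abs_fps (\<lambda>m. elem_sym m zs)"
  \<comment> \<open>Substitution turns \<open>lin (- z)\<close> into a factor with coefficient
    \<open>?c * - z\<close>, while the Kronecker product yields \<open>(-1) ^ n * z\<close>; this
    choice of \<open>?c\<close> makes them equal.\<close>
  let ?c = "(-1) ^ (n - 1) :: complex"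
  have c: "?c * - z = (-1) ^ n * z" for z
    using assms by (cases n) simp_all
  have "?E (kronecker xs (zeta_vec n)) = ?E (vec_pow xs n) oo (fps_const ?c * fps_X ^ n)"
    using prod_lin_kronecker[OF assms, of "-1" xs]
      prod_lin_compose[OF assms, of uminus "vec_pow xs n" ?c]
    unfolding elem_sym_generating_function c by simp
  then have "?E (kronecker xs (zeta_vec n)) $ m =
      (?E (vec_pow xs n) oo (fps_const ?c * fps_X ^ n)) $ m"
    by simp
  \<comment> \<open>For \<open>m = n * q\<close> the exponent is
    \<open>(n - 1) * q = m - q\<close>.\<close>
  moreover have "?c ^ (m div n) = (-1) ^ (m - m div n)" if "n dvd m"
    using that assms by (auto simp: diff_mult_distrib simp flip: power_mult)
  ultimately show ?thesis by (simp add: fps_compose_monom_nth[OF assms])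
qed

theorem theorem1p6:
  fixes k n m :: nat and \<xi> :: "complex list"
  assumes "k \<ge> 1" and "n \<ge> 1" and "length \<xi> = k"
  shows "complete_sym m (kronecker \<xi> (zeta_vec n)) =
           (if n dvd m then complete_sym (m div n) (vec_pow \<xi> n) else 0) \<and>
         elem_sym m (kronecker \<xi> (zeta_vec n)) =
           (if n dvd m \<and> m \<le> k * n
            then (-1) ^ (m - m div n) * elem_sym (m div n) (vec_pow \<xi> n) else 0)"
proof -
  \<comment> \<open>Past the bound \<open>k * n\<close> the index \<open>m div n\<close> exceeds the
    number \<open>k\<close> of variables, so the two case distinctions agree.\<close>
  have "elem_sym (m div n) (vec_pow \<xi> n) = 0" if "n dvd m" "\<not> m \<le> k * n"
  proof (rule elem_sym_eq_0)
    show "m div n > length (vec_pow \<xi> n)"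
      using that assms by (auto simp: vec_pow_def mult.commute)
  qed
  then show ?thesis
    using complete_sym_kronecker_zeta[OF assms(2)] elem_sym_kronecker_zeta[OF assms(2)] by auto
qed

end
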